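(* Let $|q|<1$ and $x\in\mathbb{C}$. Then \[ \sum_{n\geq 1} \frac{q^{2n^2-2n}\prod_{i=1}^n (1+2xq^{2i-1}+q^{4i-2})}{(q^2;q^2)_{2n-1}} =\frac{1}{(q^2;q^2)_\infty}\sum_{n\geq 0} q^{4n^2-2n}(1-q^{12n+6})\sum_{j=0}^n q^{-j^2}\big(V_j(x)+V_{j-1}(x)\big). \]
   Context: $(a;q)_n=\prod_{k=0}^{n-1}(1-aq^k)$, $(a;q)_\infty=\prod_{k\ge0}(1-aq^k)$. $V_n(x)$ is the Chebyshev polynomial of the third kind: $V_0=1$, $V_1=2x-1$, $V_n=2xV_{n-1}-V_{n-2}$ ($n>1$), and $V_n=0$ for $n<0$. (The paper writes the left sum over $n\ge0$ with the convention that the $n=0$ summand is zero.) *)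

theory Defs
  imports "HOL-Analysis.Analysis"
begin

definition qpoch :: "'a::comm_ring_1 \<Rightarrow> 'a \<Rightarrow> nat \<Rightarrow> 'a" where
  "qpoch a q n = (\<Prod>k<n. 1 - a * q ^ k)"

definition qpoch_inf :: "complex \<Rightarrow> complex \<Rightarrow> complex" where
  "qpoch_inf a q = (\<Prod>k. 1 - a * q ^ k)"

lemma convergent_prod_qpoch_inf:
  fixes a q :: complex
  assumes "norm q < 1"
  shows "convergent_prod (\<lambda>k. 1 - a * q ^ k)"
proof -
  have "summable (\<lambda>k. norm a * norm q ^ k)"
    using assms by (intro summable_mult summable_geometric) simp
  then have "summable (\<lambda>k. norm ((1 - a * q ^ k) - 1))"
    by (simp add: norm_mult norm_power)
  then show ?thesis
    by (intro abs_convergent_prod_imp_convergent_prod summable_imp_abs_convergent_prod)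
qed

fun cheb_V_nat :: "nat \<Rightarrow> 'a::comm_ring_1 \<Rightarrow> 'a" where
  "cheb_V_nat 0 x = 1"
| "cheb_V_nat (Suc 0) x = 2 * x - 1"
| "cheb_V_nat (Suc (Suc n)) x = 2 * x * cheb_V_nat (Suc n) x - cheb_V_nat n x"

text \<open>The index is an integer because the convention \<open>V\<^sub>n = 0\<close> for \<open>n < 0\<close> is used. It is not
  the backward extension of the recurrence, which would give \<open>V\<^sub>-\<^sub>1 = 1\<close>.\<close>

definition cheb_V :: "int \<Rightarrow> 'a::comm_ring_1 \<Rightarrow> 'a" where
  "cheb_V n x = (if n < 0 then 0 else cheb_V_nat (nat n) x)"

text \<open>In the summands below, all subtractions between natural numbers are exact: the left summand
  is used for \<open>n \<ge> 1\<close> only, where \<open>i \<ge> 1\<close> as well, and \<open>2 * n \<le> 4 * n\<^sup>2\<close>. For \<open>q = 0\<close>, where \<open>q\<^sup>-\<^sup>j\<^sup>2\<close>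
  is undefined on paper for \<open>j \<ge> 1\<close>, it is multiplied by \<open>q ^ (4 * n\<^sup>2 - 2 * n) = 0\<close>, in agreement
  with the total exponent \<open>4 * n\<^sup>2 - 2 * n - j\<^sup>2\<close> being positive for \<open>1 \<le> j \<le> n\<close>.\<close>

definition lhs_term :: "complex \<Rightarrow> complex \<Rightarrow> nat \<Rightarrow> complex" where
  "lhs_term q x n =
     (if n = 0 then 0
      else q ^ (2 * n\<^sup>2 - 2 * n)
             * (\<Prod>i=1..n. 1 + 2 * x * q ^ (2 * i - 1) + q ^ (4 * i - 2))
             / qpoch (q\<^sup>2) (q\<^sup>2) (2 * n - 1))"

definition rhs_term :: "complex \<Rightarrow> complex \<Rightarrow> nat \<Rightarrow> complex" where
  "rhs_term q x n =
     q ^ (4 * n\<^sup>2 - 2 * n) * (1 - q ^ (12 * n + 6))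
       * (\<Sum>j=0..n. q powi (- (int j ^ 2)) * (cheb_V (int j) x + cheb_V (int j - 1) x))"

end

theory Submission
  imports Defs
begin

text \<open>
  Put \<open>Q = q\<^sup>2\<close>. The numbers \<open>d\<^sub>j = V\<^sub>j(x) + V\<^sub>j\<^sub>-\<^sub>1(x)\<close> satisfy \<open>d\<^sub>0 = 1\<close> and
  \<open>d\<^sub>j = z\<^sup>j + z\<^sup>-\<^sup>j\<close> for \<open>j \<ge> 1\<close>, where \<open>2x = z + 1/z\<close>. Hence the finite Jacobi triple product expands
  the left summand as a combination of \<open>d\<^sub>0, \<dots>, d\<^sub>n\<close>, and after exchanging the order of summation
  it remains to compare the coefficients of \<open>d\<^sub>j\<close>. On the left, the coefficient is a combination of
  the sums \<open>H(a, N) = \<Sum>\<^sub>m Q\<^bsup>m\<^sup>2 + a m\<^esup> / ((Q)\<^sub>m (Q)\<^sub>m\<^sub>+\<^sub>N)\<close> with \<open>N = 2j\<close> and \<open>a = N \<plusminus> 1\<close>. Two contiguous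
  relations for \<open>H\<close> give \<open>(Q)\<^sub>\<infinity> H(N, N) = 1\<close>, \<open>(Q)\<^sub>\<infinity> H(N - 1, N) = 1 + Q\<^sup>N\<close> and
  \<open>H(N + 1, N) = 1/(Q)\<^sub>\<infinity> - Q\<^bsup>N + 1\<^esup> H(N + 2, N + 1)\<close>. Iterating the last one produces the partial
  theta series on the right.
\<close>

section \<open>Convergence\<close>

text \<open>The term equals \<open>(c * r ^ n) ^ n\<close>, whose base tends to 0, so a geometric
  series of ratio 1/2 eventually dominates it, however large \<open>c\<close> is. This covers
  negative powers of \<open>norm q\<close> as well as the exponential growth of the Chebyshev
  factors.\<close>

lemma summable_power_mult_power_square:
  fixes c r :: real
  assumes "0 \<le> c" "0 \<le> r" "r < 1"
  shows "summable (\<lambda>n. c ^ n * r ^ (n\<^sup>2))"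
proof (rule summable_comparison_test_ev)
  have "(\<lambda>n. c * r ^ n) \<longlonglongrightarrow> c * 0"
    using assms by (intro tendsto_mult tendsto_const LIMSEQ_realpow_zero) auto
  then have "eventually (\<lambda>n. c * r ^ n < 1 / 2) sequentially"
    by (rule order_tendstoD) simp
  then show "eventually (\<lambda>n. norm (c ^ n * r ^ (n\<^sup>2)) \<le> (1 / 2) ^ n) sequentially"
  proof eventually_elim
    case (elim n)
    have "c ^ n * r ^ (n\<^sup>2) = (c * r ^ n) ^ n"
      by (simp add: power_mult_distrib power_mult power2_eq_square)
    also have "\<dots> \<le> (1 / 2) ^ n"
      using elim assms by (intro power_mono) auto
    finally show ?case
      using assms by simp
  qed
qed (simp add: summable_geometric)

lemma summable_norm_powi_quadratic:
  fixes q :: complex and a :: int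
  assumes "norm q < 1" "q \<noteq> 0"
  shows "summable (\<lambda>m. norm (q powi (int m ^ 2 + a * int m)))"
proof -
  have "norm (q powi (int m ^ 2 + a * int m)) = (norm q powi a) ^ m * norm q ^ (m\<^sup>2)" for m
  proof -
    have "q powi (int m ^ 2 + a * int m) = q ^ (m\<^sup>2) * (q powi a) ^ m"
      using assms by (simp add: power_int_add power_int_mult flip: of_nat_power)
    then show ?thesis
      by (simp add: norm_mult norm_power norm_power_int)
  qed
  then show ?thesis
    using assms summable_power_mult_power_square[of "norm q powi a" "norm q"] by simp
qed

text \<open>Extending \<open>g\<close> by zero to all index pairs reduces the exchange to Fubini for
  an absolutely summable family, dominated by the product \<open>b n * a j\<close>. Column
  \<open>j\<close> starts at \<open>n = j\<close>, hence the shift \<open>n = m + j\<close>.\<close>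

lemma triangular_sum_swap:
  fixes g :: "nat \<Rightarrow> nat \<Rightarrow> 'a::banach" and a b :: "nat \<Rightarrow> real"
  assumes "summable a" "summable b" "\<And>n. 0 \<le> a n" "\<And>n. 0 \<le> b n"
    and le: "\<And>n j. j \<le> n \<Longrightarrow> norm (g n j) \<le> b n * a j"
  shows "summable (\<lambda>n. \<Sum>j\<le>n. g n j)"
    and "summable (\<lambda>j. \<Sum>m. g (m + j) j)"
    and "(\<Sum>n. \<Sum>j\<le>n. g n j) = (\<Sum>j. \<Sum>m. g (m + j) j)"
proof -
  define G where "G n j = (if j \<le> n then g n j else 0)" for n j
  have ab: "(\<lambda>x. norm (a x)) summable_on UNIV" "(\<lambda>x. norm (b x)) summable_on UNIV"
    using assms by (auto simp: summable_on_UNIV_nonneg_real_iff)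
  have "(\<lambda>p. norm ((\<lambda>(n, j). b n * a j) p)) summable_on UNIV \<times> UNIV"
    unfolding Infinite_Sum.abs_summable_on_Sigma_iff using ab assms
    by (auto simp: norm_mult abs_mult infsum_cmult_right'
        intro!: summable_on_cmult_right summable_on_cmult_left)
  then have "(\<lambda>(n, j). b n * a j) summable_on UNIV \<times> UNIV"
    by (rule abs_summable_summable)
  then have abs: "(\<lambda>p. norm ((\<lambda>(n, j). G n j) p)) summable_on UNIV \<times> UNIV"
    by (rule Infinite_Sum.abs_summable_on_comparison_test') (use le assms in \<open>auto simp: G_def\<close>)
  then have sm: "(\<lambda>(n, j). G n j) summable_on UNIV \<times> UNIV"
    by (rule abs_summable_summable)
  have sm': "(\<lambda>(j, n). G n j) summable_on UNIV \<times> UNIV"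
    using summable_on_swap[of "\<lambda>(n, j). G n j" UNIV UNIV] sm by (simp add: case_prod_beta)
  have row: "infsum (G n) UNIV = (\<Sum>j\<le>n. g n j)" for n
    by (subst infsum_cong_neutral[where T = "{..n}" and g = "g n"]) (auto simp: G_def)
  have srow: "(\<lambda>n. \<Sum>j\<le>n. g n j) summable_on UNIV"
    using summable_on_Sigma_banach[OF sm] by (simp add: row)
  show "summable (\<lambda>n. \<Sum>j\<le>n. g n j)"
    by (rule summable_on_imp_summable[OF srow])
  have suminf_eq: "suminf f = infsum f UNIV" if "f summable_on UNIV" for f :: "nat \<Rightarrow> 'a"
    using has_sum_imp_sums[OF has_sum_infsum[OF that]] by (simp add: sums_iff)
  have scol: "(\<lambda>n. G n j) summable_on UNIV" for j
  proof (rule norm_summable_imp_summable_on, rule summable_comparison_test'[where N = 0])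
    show "summable (\<lambda>n. b n * a j)"
      by (rule summable_mult2[OF \<open>summable b\<close>])
  qed (use le assms in \<open>auto simp: G_def\<close>)
  have col: "infsum (\<lambda>n. G n j) UNIV = (\<Sum>m. g (m + j) j)" for j
  proof -
    have "infsum (\<lambda>n. G n j) UNIV = (\<Sum>n. G n j)"
      using suminf_eq[OF scol] by simp
    also have "\<dots> = (\<Sum>n. G (n + j) j) + (\<Sum>n<j. G n j)"
      by (rule suminf_split_initial_segment[OF summable_on_imp_summable[OF scol]])
    also have "\<dots> = (\<Sum>m. g (m + j) j)"
      by (simp add: G_def)
    finally show ?thesis .
  qed
  show "summable (\<lambda>j. \<Sum>m. g (m + j) j)"
    using summable_on_imp_summable[OF summable_on_Sigma_banach[OF sm']] by (simp add: col)
  have "(\<Sum>n. \<Sum>j\<le>n. g n j) = infsum (\<lambda>n. infsum (G n) UNIV) UNIV"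
    by (simp add: suminf_eq[OF srow] row)
  also have "\<dots> = infsum (\<lambda>j. infsum (\<lambda>n. G n j) UNIV) UNIV"
    by (rule infsum_swap_banach[OF sm])
  also have "\<dots> = (\<Sum>j. infsum (\<lambda>n. G n j) UNIV)"
    using summable_on_Sigma_banach[OF sm'] by (subst suminf_eq) simp_all
  finally show "(\<Sum>n. \<Sum>j\<le>n. g n j) = (\<Sum>j. \<Sum>m. g (m + j) j)"
    by (simp add: col)
qed

section \<open>Reciprocal q-factorials\<close>

lemma one_minus_power_nonzero:
  fixes q :: complex
  assumes "norm q < 1" "0 < k"
  shows "1 - q ^ k \<noteq> 0"
proof
  assume "1 - q ^ k = 0"
  then have "norm q ^ k = 1"
    by (simp flip: norm_power)
  then show False
    using assms power_less_one_iff[of "norm q" k] by simp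
qed

lemma qpoch_nonzero:
  fixes q :: complex
  assumes "norm q < 1"
  shows "qpoch q q n \<noteq> 0"
  using one_minus_power_nonzero[OF assms, of "Suc _"] by (auto simp: qpoch_def)

lemma qpoch_inf_nonzero:
  assumes "norm q < 1"
  shows "qpoch_inf q q \<noteq> 0"
  unfolding qpoch_inf_def
  using one_minus_power_nonzero[OF assms, of "Suc _"]
  by (intro prodinf_nonzero convergent_prod_qpoch_inf assms) auto

lemma qpoch_tendsto:
  assumes "norm q < 1"
  shows "qpoch a q \<longlonglongrightarrow> qpoch_inf a q"
  unfolding qpoch_inf_def qpoch_def
  using convergent_prod_LIMSEQ[OF convergent_prod_qpoch_inf[OF assms, of a]]
  by (simp add: LIMSEQ_lessThan_iff_atMost)

text \<open>The value 0 at negative indices is the usual convention for 1/(q;q)_k. It makes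
  \<open>rqf_pred\<close> valid for every integer and truncates sums without case
  distinctions.\<close>

definition rqf :: "complex \<Rightarrow> int \<Rightarrow> complex" where
  "rqf q k = (if k < 0 then 0 else 1 / qpoch q q (nat k))"

lemma rqf_of_nat: "rqf q (int n) = 1 / qpoch q q n"
  by (simp add: rqf_def)

lemma rqf_neg [simp]: "k < 0 \<Longrightarrow> rqf q k = 0"
  by (simp add: rqf_def)

lemma rqf_0 [simp]: "rqf q 0 = 1"
  by (simp add: rqf_def qpoch_def)

lemma rqf_pred:
  assumes "norm q < 1"
  shows "rqf q (k - 1) = (1 - q powi k) * rqf q k"
proof (cases "k \<le> 0")
  case True
  then show ?thesis
    \<comment> \<open>At \<open>k = 0\<close> the factor \<open>1 - q powi 0\<close> vanishes,
      matching \<open>rqf q (-1) = 0\<close>.\<close>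
    by (cases "k = 0") auto
next
  case False
  then obtain n where k: "k = int (Suc n)"
    by (metis gr0_implies_Suc not_le pos_int_cases)
  have "q powi k = q ^ Suc n"
    unfolding k by (rule power_int_of_nat)
  moreover have "rqf q (k - 1) = 1 / qpoch q q n"
    by (simp add: k rqf_of_nat)
  moreover have "qpoch q q (Suc n) = qpoch q q n * (1 - q ^ Suc n)"
    by (simp add: qpoch_def)
  ultimately show ?thesis
    using one_minus_power_nonzero[OF assms, of "Suc n"]
    unfolding k rqf_of_nat by (simp del: power_Suc)
qed

text \<open>The finite products tend to a nonzero limit, so their reciprocals converge and are
  bounded.\<close>

lemma rqf_bounded:
  assumes "norm q < 1"
  obtains K where "0 < K" "\<And>k. norm (rqf q k) \<le> K"
proof -
  have "(\<lambda>n. 1 / qpoch q q n) \<longlonglongrightarrow> 1 / qpoch_inf q q"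
    by (intro tendsto_divide tendsto_const qpoch_tendsto qpoch_inf_nonzero assms)
  then have "Bseq (\<lambda>n. 1 / qpoch q q n)"
    by (intro convergent_imp_Bseq convergentI)
  then obtain K where "0 < K" "\<And>n. norm (1 / qpoch q q n) \<le> K"
    by (auto elim: BseqE)
  then show ?thesis
    by (intro that[of K]) (auto simp: rqf_def)
qed

section \<open>Durfee-type sums\<close>

text \<open>For \<open>a = N\<close> this is the summand of Cauchy's Durfee rectangle series.
  Keeping \<open>a\<close> free allows contiguous relations that move \<open>a\<close> and
  \<open>N\<close> separately. The base \<open>q\<close> is later taken to be the square of the
  \<open>q\<close> in the theorem.\<close>

definition durfee_term :: "complex \<Rightarrow> int \<Rightarrow> int \<Rightarrow> nat \<Rightarrow> complex" where
  "durfee_term q a N m = q powi (int m ^ 2 + a * int m) * rqf q (int m) * rqf q (int m + N)"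

definition durfee_sum :: "complex \<Rightarrow> int \<Rightarrow> int \<Rightarrow> complex" where
  "durfee_sum q a N = (\<Sum>m. durfee_term q a N m)"

context
  fixes q :: complex
  assumes q: "norm q < 1" "q \<noteq> 0"
begin

lemma summable_durfee_term: "summable (durfee_term q a N)"
proof -
  obtain K where K: "0 < K" "\<And>k. norm (rqf q k) \<le> K"
    using rqf_bounded q by blast
  show ?thesis
  proof (rule summable_comparison_test'[where N = 0])
    show "summable (\<lambda>m. norm (q powi (int m ^ 2 + a * int m)) * (K * K))"
      by (intro summable_mult2 summable_norm_powi_quadratic q)
    show "norm (durfee_term q a N m) \<le> norm (q powi (int m ^ 2 + a * int m)) * (K * K)" for m
      unfolding durfee_term_def norm_mult mult.assoc
      using K by (intro mult_left_mono mult_mono) (auto intro: order.trans[OF norm_ge_zero])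
  qed
qed

text \<open>By \<open>rqf_pred\<close>, lowering the index \<open>m + N + 1\<close> costs a factor 1
  - q^(m+N+1); its q^m turns \<open>a\<close> into \<open>a + 1\<close>.\<close>

lemma durfee_sum_raise_N:
  "durfee_sum q a N = durfee_sum q a (N + 1) - q powi (N + 1) * durfee_sum q (a + 1) (N + 1)"
proof -
  have "durfee_term q a N m
          = durfee_term q a (N + 1) m - q powi (N + 1) * durfee_term q (a + 1) (N + 1) m" for m
  proof -
    have r: "rqf q (int m + N) = (1 - q powi (int m + N + 1)) * rqf q (int m + N + 1)"
      using rqf_pred[OF q(1), of "int m + N + 1"] by simp
    have "q powi (N + 1) * q powi (int m ^ 2 + (a + 1) * int m)
            = q powi (int m ^ 2 + a * int m) * q powi (int m + N + 1)"
      using q(2) by (simp add: algebra_simps flip: power_int_add)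
    then show ?thesis
      unfolding durfee_term_def r by (simp add: algebra_simps)
  qed
  then have "durfee_term q a N
      = (\<lambda>m. durfee_term q a (N + 1) m - q powi (N + 1) * durfee_term q (a + 1) (N + 1) m)"
    by blast
  then show ?thesis
    unfolding durfee_sum_def
    by (simp only:) (intro sums_unique[symmetric] sums_diff sums_mult summable_sums
      summable_durfee_term)
qed

text \<open>The termwise difference for \<open>a\<close> and \<open>a + 1\<close> carries 1 - q^m,
  which lowers \<open>rqf q m\<close> to \<open>rqf q (m - 1)\<close>. The term at
  \<open>m = 0\<close> thus vanishes, and shifting \<open>m\<close> by one gives the last
  sum.\<close>

lemma durfee_sum_raise_a:
  "durfee_sum q a N = durfee_sum q (a + 1) N + q powi (a + 1) * durfee_sum q (a + 2) (N + 1)"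
proof -
  let ?f = "\<lambda>m. durfee_term q a N m - durfee_term q (a + 1) N m"
  have f: "?f m = q powi (int m ^ 2 + a * int m) * rqf q (int m - 1) * rqf q (int m + N)" for m
  proof -
    have "q powi (int m ^ 2 + (a + 1) * int m) = q powi (int m ^ 2 + a * int m) * q powi int m"
      using q(2) by (simp add: algebra_simps flip: power_int_add del: power_int_of_nat)
    then show ?thesis
      unfolding durfee_term_def rqf_pred[OF q(1), of "int m"] by (simp add: algebra_simps)
  qed
  have sf: "summable ?f"
    by (intro summable_diff summable_durfee_term)
  have fS: "?f (Suc m) = q powi (a + 1) * durfee_term q (a + 2) (N + 1) m" for m
  proof -
    have "int (Suc m) ^ 2 + a * int (Suc m) = (a + 1) + (int m ^ 2 + (a + 2) * int m)"
      by (simp add: power2_eq_square algebra_simps)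
    then have "q powi (int (Suc m) ^ 2 + a * int (Suc m))
                 = q powi (a + 1) * q powi (int m ^ 2 + (a + 2) * int m)"
      using q(2) by (simp only: power_int_add simp_thms)
    then show ?thesis
      by (subst f) (simp add: durfee_term_def add_ac)
  qed
  have "durfee_sum q a N - durfee_sum q (a + 1) N = suminf ?f"
    unfolding durfee_sum_def by (rule suminf_diff[OF summable_durfee_term summable_durfee_term])
  also have "\<dots> = (\<Sum>m. ?f (Suc m)) + ?f 0"
    using suminf_split_head[OF sf] by simp
  also have "?f 0 = 0"
    unfolding f by simp
  also have "(\<Sum>m. ?f (Suc m)) = q powi (a + 1) * durfee_sum q (a + 2) (N + 1)"
    unfolding fS durfee_sum_def by (rule suminf_mult[OF summable_durfee_term])
  finally show ?thesis
    by (simp add: algebra_simps)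
qed

text \<open>The subtracted product is the term at \<open>m = 0\<close>. All later exponents satisfy
  (m+1)^2 + a(m+1) >= a + m, and the bound is uniform in \<open>N\<close>. It yields both the limit
  along the diagonal and the boundedness of the superdiagonal sums.\<close>

lemma durfee_sum_tail_bound:
  obtains C where "\<And>a N. 0 \<le> a \<Longrightarrow> norm (durfee_sum q a N - rqf q 0 * rqf q N) \<le> C * norm q powi a"
proof -
  obtain K where K: "0 < K" "\<And>k. norm (rqf q k) \<le> K"
    using rqf_bounded q by blast
  let ?b = "\<lambda>m. norm q ^ m * (K * K)"
  have sb: "summable ?b"
    using q by (intro summable_mult2 summable_geometric) simp
  have "norm (durfee_sum q a N - rqf q 0 * rqf q N) \<le> suminf ?b * norm q powi a"
    if a: "0 \<le> a" for a N
  proof -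
    have le: "norm (durfee_term q a N (Suc m)) \<le> norm q powi a * ?b m" for m
    proof -
      have "norm (q powi (int (Suc m) ^ 2 + a * int (Suc m))) \<le> norm q powi (a + int m)"
        unfolding norm_power_int
      proof (rule power_int_decreasing)
        have "a * 1 \<le> a * int (Suc m)"
          using a by (intro mult_left_mono) auto
        moreover have "int m \<le> int (Suc m) ^ 2"
          by (simp add: power2_eq_square algebra_simps)
        ultimately show "a + int m \<le> int (Suc m) ^ 2 + a * int (Suc m)"
          by simp
      qed (use q in auto)
      also have "\<dots> = norm q powi a * norm q ^ m"
        using q by (simp add: power_int_add)
      finally show ?thesis
        unfolding durfee_term_def norm_mult mult.assoc[symmetric] using K
        by (intro mult_mono) (auto intro: order.trans[OF norm_ge_zero])
    qed
    have s: "summable (\<lambda>m. norm (durfee_term q a N (Suc m)))"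
      by (rule summable_comparison_test'[OF summable_mult[OF sb, of "norm q powi a"], where N = 0])
         (use le in simp)
    have "durfee_sum q a N - rqf q 0 * rqf q N = (\<Sum>m. durfee_term q a N (Suc m))"
      unfolding durfee_sum_def using suminf_split_head[OF summable_durfee_term[of a N]]
      by (simp add: durfee_term_def)
    also have "norm \<dots> \<le> (\<Sum>m. norm (durfee_term q a N (Suc m)))"
      by (rule summable_norm[OF s])
    also have "\<dots> \<le> (\<Sum>m. norm q powi a * ?b m)"
      by (intro suminf_le le s summable_mult sb)
    also have "\<dots> = suminf ?b * norm q powi a"
      by (subst suminf_mult[OF sb]) simp
    finally show ?thesis .
  qed
  then show ?thesis
    using that by blast
qed

text \<open>The two recurrences show that the diagonal sums do not depend on \<open>N\<close>; then let
  \<open>N\<close> tend to infinity.\<close>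

lemma durfee_sum_diagonal:
  "durfee_sum q (int N) (int N) = 1 / qpoch_inf q q"
proof -
  \<comment> \<open>Raising \<open>a\<close> from (n, n), then \<open>N\<close> from (n+1, n),
    produces q^(n+1) times the sum at (n+2, n+1) with opposite signs; these cancel, leaving the sum
    at (n+1, n+1).\<close>
  have "durfee_sum q (int n) (int n) = durfee_sum q 0 0" for n
  proof (induction n)
    case (Suc n)
    then show ?case
      using durfee_sum_raise_a[of "int n" "int n"] durfee_sum_raise_N[of "int n + 1" "int n"]
      by (simp add: add_ac)
  qed simp
  moreover have "(\<lambda>n. durfee_sum q (int n) (int n)) \<longlonglongrightarrow> 1 / qpoch_inf q q"
  proof -
    obtain C where C: "\<And>a N. 0 \<le> a \<Longrightarrow>
        norm (durfee_sum q a N - rqf q 0 * rqf q N) \<le> C * norm q powi a"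
      using durfee_sum_tail_bound by blast
    have "(\<lambda>n. durfee_sum q (int n) (int n) - 1 / qpoch q q n) \<longlonglongrightarrow> 0"
    proof (rule Lim_null_comparison)
      show "\<forall>\<^sub>F n in sequentially. norm (durfee_sum q (int n) (int n) - 1 / qpoch q q n)
              \<le> C * norm q ^ n"
        using C[of "int _" "int _"] by (simp add: rqf_of_nat)
      show "(\<lambda>n. C * norm q ^ n) \<longlonglongrightarrow> 0"
        using q by (intro tendsto_mult_right_zero LIMSEQ_realpow_zero) auto
    qed
    moreover have "(\<lambda>n. 1 / qpoch q q n) \<longlonglongrightarrow> 1 / qpoch_inf q q"
      by (intro tendsto_divide tendsto_const qpoch_tendsto qpoch_inf_nonzero q)
    ultimately show ?thesis
      using tendsto_add by fastforce
  qed
  ultimately show ?thesis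
    by (simp add: LIMSEQ_const_iff)
qed

text \<open>Raising \<open>a\<close> from N - 1 lands on the two diagonal sums at (N, N) and (N+1,
  N+1).\<close>

lemma durfee_sum_subdiagonal:
  "durfee_sum q (int N - 1) (int N) = (1 + q ^ N) / qpoch_inf q q"
  using durfee_sum_raise_a[of "int N - 1" "int N"] durfee_sum_diagonal[of N]
    durfee_sum_diagonal[of "Suc N"]
  by (simp add: add_ac add_divide_distrib)

lemma durfee_sum_superdiagonal:
  "durfee_sum q (int N + 1) (int N)
     = 1 / qpoch_inf q q - q ^ Suc N * durfee_sum q (int (Suc N) + 1) (int (Suc N))"
proof -
  have "q powi (int N + 1) = q ^ Suc N"
    using power_int_of_nat[of q "Suc N"] by (simp add: add_ac)
  then show ?thesis
    using durfee_sum_raise_N[of "int N + 1" "int N"] durfee_sum_diagonal[of "Suc N"]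
    by (simp add: add_ac)
qed

text \<open>Iterating the recurrence for the superdiagonal sums twice gives a telescoping series.\<close>

lemma column_sums:
  "(\<lambda>m. q powi (2 * int (m + j) ^ 2 - int (m + j)) * (1 - q ^ (6 * (m + j) + 3))) sums
     (q powi (2 * int j ^ 2 - int j) * (1 + q ^ (2 * j))
       - qpoch_inf q q * q powi (2 * int j ^ 2 + int j)
           * durfee_sum q (int (2 * j) + 1) (int (2 * j)))"
proof -
  \<comment> \<open>\<open>W j\<close> is the proposed value of the series starting at index
    \<open>j\<close>. It suffices that its differences are the terms and that it tends to 0.\<close>
  define W where "W j = q powi (2 * int j ^ 2 - int j) * (1 + q ^ (2 * j))
       - qpoch_inf q q * q powi (2 * int j ^ 2 + int j)
           * durfee_sum q (int (2 * j) + 1) (int (2 * j))" for j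
  have step: "W n - W (Suc n) = q powi (2 * int n ^ 2 - int n) * (1 - q ^ (6 * n + 3))" for n
  proof -
    define A where "A = durfee_sum q (int (2 * Suc n) + 1) (int (2 * Suc n))"
    \<comment> \<open>With \<open>u\<close> and \<open>v\<close> all powers become monomials. Since
      \<open>N = 2 * n\<close> grows by 2, the superdiagonal recurrence is applied twice; the
      resulting multiple of \<open>A\<close> is the same in \<open>W n\<close> and
      \<open>W (Suc n)\<close> and cancels.\<close>
    define u v where "u = q powi (2 * int n ^ 2 - int n)" and "v = q ^ n"
    have P: "qpoch_inf q q \<noteq> 0"
      by (rule qpoch_inf_nonzero[OF q(1)])
    have D: "durfee_sum q (int (2 * n) + 1) (int (2 * n))
        = 1 / qpoch_inf q q - q ^ Suc (2 * n) * (1 / qpoch_inf q q - q ^ Suc (Suc (2 * n)) * A)"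
      using durfee_sum_superdiagonal[of "2 * n"] durfee_sum_superdiagonal[of "Suc (2 * n)"]
      by (simp add: A_def)
    have e1: "q powi (2 * int n ^ 2 + int n) = u * v ^ 2"
    proof -
      have "2 * int n ^ 2 + int n = (2 * int n ^ 2 - int n) + int (n * 2)" by simp
      then show ?thesis unfolding u_def v_def power_mult[symmetric]
        using q(2) by (simp only: power_int_add power_int_of_nat simp_thms)
    qed
    have e2: "q powi (2 * int (Suc n) ^ 2 - int (Suc n)) = u * v ^ 4 * q"
    proof -
      have "2 * int (Suc n) ^ 2 - int (Suc n) = (2 * int n ^ 2 - int n) + int (n * 4) + 1"
        by (simp add: power2_eq_square algebra_simps)
      then show ?thesis unfolding u_def v_def power_mult[symmetric]
        using q(2) by (simp only: power_int_add power_int_of_nat power_int_1_right simp_thms)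
    qed
    have e3: "q powi (2 * int (Suc n) ^ 2 + int (Suc n)) = u * v ^ 6 * q ^ 3"
    proof -
      have "2 * int (Suc n) ^ 2 + int (Suc n) = (2 * int n ^ 2 - int n) + int (n * 6) + int 3"
        by (simp add: power2_eq_square algebra_simps)
      then show ?thesis unfolding u_def v_def power_mult[symmetric]
        using q(2) by (simp only: power_int_add power_int_of_nat power_int_1_right simp_thms)
    qed
    have e4: "q ^ (2 * n) = v ^ 2" "q ^ (6 * n + 3) = v ^ 6 * q ^ 3"
        "q ^ (2 * Suc n) = v ^ 2 * q ^ 2" "q ^ Suc (2 * n) = v ^ 2 * q"
        "q ^ Suc (Suc (2 * n)) = v ^ 2 * q ^ 2"
      by (simp_all add: v_def power_add power2_eq_square mult_ac power_mult[symmetric] mult_2_right)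
    have "W n = u * (1 + v ^ 2) - u * v ^ 2 * (1 - v ^ 2 * q * (1 - v ^ 2 * q ^ 2 * (qpoch_inf q q * A)))"
      unfolding W_def D e1 e4 u_def[symmetric] using P by (simp add: field_simps)
    moreover have "W (Suc n) = u * v ^ 4 * q * (1 + v ^ 2 * q ^ 2) - u * v ^ 6 * q ^ 3 * (qpoch_inf q q * A)"
      unfolding W_def A_def[symmetric] e2 e3 e4 by (simp add: mult_ac)
    ultimately show ?thesis
      unfolding u_def[symmetric] e4 by algebra
  qed
  have lim: "W \<longlonglongrightarrow> 0"
  proof -
    obtain C where C: "\<And>a N. 0 \<le> a \<Longrightarrow>
        norm (durfee_sum q a N - rqf q 0 * rqf q N) \<le> C * norm q powi a"
      using durfee_sum_tail_bound by blast
    obtain K where K: "0 < K" "\<And>k. norm (rqf q k) \<le> K"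
      using rqf_bounded q by blast
    \<comment> \<open>Both exponents 2n^2 - n and 2n^2 + n are at least n, 1 + q^(2n) has norm at
      most 2, and the superdiagonal sums have norm at most |C| + K.\<close>
    define B where "B = 2 + norm (qpoch_inf q q) * (\<bar>C\<bar> + K)"
    have "norm (W n) \<le> norm q ^ n * B" for n
    proof -
      have le1: "norm (q powi k) \<le> norm q ^ n" if "int n \<le> k" for k
        unfolding norm_power_int power_int_of_nat[symmetric]
        using that q by (intro power_int_decreasing) auto
      have nn: "int n \<le> int n ^ 2"
        by (cases n) (auto simp: power2_eq_square algebra_simps)
      have D: "norm (durfee_sum q (int (2 * n) + 1) (int (2 * n))) \<le> \<bar>C\<bar> + K"
      proof -
        have "norm (durfee_sum q (int (2 * n) + 1) (int (2 * n)))
          \<le> norm (durfee_sum q (int (2 * n) + 1) (int (2 * n)) - rqf q 0 * rqf q (int (2 * n)))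
             + norm (rqf q 0 * rqf q (int (2 * n)))"
          by (subst add.commute) (rule norm_triangle_sub)
        also have "\<dots> \<le> C * norm q powi (int (2 * n) + 1) + K"
          using C[of "int (2 * n) + 1" "int (2 * n)"] K(2)[of "int (2 * n)"]
          by (intro add_mono) simp_all
        also have "C * norm q powi (int (2 * n) + 1) \<le> \<bar>C\<bar> * 1"
        proof (rule mult_mono)
          show "norm q powi (int (2 * n) + 1) \<le> 1"
            using power_int_decreasing[of 0 "int (2 * n) + 1" "norm q"] q by simp
        qed auto
        finally show ?thesis by simp
      qed
      have "norm (W n) \<le> norm (q powi (2 * int n ^ 2 - int n)) * norm (1 + q ^ (2 * n))
          + norm (qpoch_inf q q) * norm (q powi (2 * int n ^ 2 + int n))
             * norm (durfee_sum q (int (2 * n) + 1) (int (2 * n)))"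
        unfolding W_def norm_mult[symmetric] by (rule norm_triangle_ineq4)
      also have "\<dots> \<le> norm q ^ n * 2 + norm (qpoch_inf q q) * norm q ^ n * (\<bar>C\<bar> + K)"
      proof (intro add_mono mult_mono le1 D)
        have "norm (1 + q ^ (2 * n)) \<le> norm (1 :: complex) + norm (q ^ (2 * n))"
          by (rule norm_triangle_ineq)
        also have "norm (q ^ (2 * n)) \<le> 1"
          using q by (simp add: norm_power power_le_one)
        finally show "norm (1 + q ^ (2 * n)) \<le> 2" by simp
      qed (use nn in auto)
      also have "\<dots> = norm q ^ n * B"
        by (simp add: B_def algebra_simps)
      finally show ?thesis .
    qed
    moreover have "(\<lambda>n. norm q ^ n * B) \<longlonglongrightarrow> 0"
      using q by (intro tendsto_mult_left_zero LIMSEQ_realpow_zero) auto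
    ultimately show ?thesis
      by (intro Lim_null_comparison[where f = W]) auto
  qed
  have "(\<lambda>m. W (m + j)) \<longlonglongrightarrow> 0"
    using lim by (rule LIMSEQ_ignore_initial_segment)
  from telescope_sums'[OF this] show ?thesis
    using step by (simp add: W_def[of j])
qed

end

section \<open>The finite Jacobi triple product\<close>

text \<open>For \<open>j\<close> >= 1 this is twice the Chebyshev polynomial of the first kind. At
  \<open>j = 0\<close> the convention for negative indices gives 1 instead of 2, so that for
  symmetric F a sum of \<open>cheb_coeff x j\<close> times F(j) over \<open>j\<close> >= 0 stands
  for the sum of z^j F(j) over all integers, where 2x = z + 1/z.\<close>

definition cheb_coeff :: "'a::comm_ring_1 \<Rightarrow> nat \<Rightarrow> 'a" where
  "cheb_coeff x j = cheb_V (int j) x + cheb_V (int j - 1) x"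

lemma cheb_coeff_simps [simp]:
  "cheb_coeff x 0 = 1"
  "cheb_coeff x (Suc 0) = 2 * x"
  by (simp_all add: cheb_coeff_def cheb_V_def)

lemma cheb_coeff_2: "cheb_coeff x (Suc (Suc 0)) = 2 * x * cheb_coeff x (Suc 0) - 2"
  by (simp add: cheb_coeff_def cheb_V_def nat_add_distrib numeral_2_eq_2 algebra_simps)

lemma cheb_coeff_rec:
  "cheb_coeff x (Suc (Suc (Suc j))) = 2 * x * cheb_coeff x (Suc (Suc j)) - cheb_coeff x (Suc j)"
proof -
  have "cheb_coeff x (Suc k) = cheb_V_nat (Suc k) x + cheb_V_nat k x" for k
    by (simp add: cheb_coeff_def cheb_V_def nat_add_distrib)
  then show ?thesis
    by (simp add: algebra_simps)
qed

lemma norm_cheb_coeff_le: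
  fixes x :: complex
  shows "norm (cheb_coeff x j) \<le> (2 * norm x + 2) ^ j"
proof (induction j rule: less_induct)
  case (less j)
  let ?c = "2 * norm x + 2"
  consider "j = 0" | "j = 1" | k where "j = Suc (Suc k)"
    by (metis One_nat_def not0_implies_Suc)
  then show ?case
  proof cases
    case 3
    \<comment> \<open>The factor 2 covers the exceptional recurrence at index 2, where 2 is
      subtracted; it is absorbed below because 2 <= \<open>?c\<close>.\<close>
    have "norm (cheb_coeff x j) \<le> norm (2 * x * cheb_coeff x (Suc k)) + 2 * norm (cheb_coeff x k)"
    proof (cases k)
      case 0
      then show ?thesis
        using norm_triangle_ineq4[of "2 * x * cheb_coeff x (Suc k)" 2] 3
        by (simp add: cheb_coeff_2)
    next
      case (Suc i)
      then show ?thesis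
        using norm_triangle_ineq4[of "2 * x * cheb_coeff x (Suc k)" "cheb_coeff x k"] 3
          norm_ge_zero[of "cheb_coeff x k"]
        unfolding 3 Suc cheb_coeff_rec by linarith
    qed
    also have "\<dots> = 2 * norm x * norm (cheb_coeff x (Suc k)) + 2 * norm (cheb_coeff x k)"
      by (simp add: norm_mult)
    also have "\<dots> \<le> 2 * norm x * ?c ^ Suc k + ?c * ?c ^ k"
      using less[of "Suc k"] less[of k] 3 by (intro add_mono mult_mono) auto
    also have "\<dots> \<le> ?c ^ j"
      using 3 by (simp add: algebra_simps)
    finally show ?thesis .
  qed auto
qed

text \<open>Multiplication by z + 1/z shifts the coefficients of a symmetric Laurent series both
  ways. The hypothesis supplies the reflection at the origin, where it pairs with the exceptional 2
  in \<open>cheb_coeff_2\<close>; the last two terms correct for truncation at the top.\<close>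

lemma cheb_coeff_summation_by_parts:
  fixes F :: "int \<Rightarrow> 'a::comm_ring_1"
  assumes "F (-1) = F 1"
  shows "2 * x * (\<Sum>j\<le>Suc M. cheb_coeff x j * F (int j))
    = (\<Sum>j\<le>Suc M. cheb_coeff x j * (F (int j - 1) + F (int j + 1)))
      + cheb_coeff x (Suc (Suc M)) * F (int (Suc M))
      - cheb_coeff x (Suc M) * F (int (Suc (Suc M)))"
proof (induction M)
  case 0
  then show ?case
    using assms by (simp add: cheb_coeff_2 algebra_simps)
next
  case (Suc M)
  show ?case
    by (subst (1 2) sum.atMost_Suc, subst distrib_left, subst Suc.IH)
       (simp add: cheb_coeff_rec[of x M] algebra_simps)
qed

text \<open>This is q^(j^2) times the Gaussian binomial coefficient of 2n over n + j in base q^2. It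
  is symmetric in \<open>j\<close> and vanishes for |j| > n.\<close>

definition triple_coeff :: "complex \<Rightarrow> nat \<Rightarrow> int \<Rightarrow> complex" where
  "triple_coeff q n j = qpoch (q\<^sup>2) (q\<^sup>2) (2 * n) * q powi (j ^ 2)
     * rqf (q\<^sup>2) (int n - j) * rqf (q\<^sup>2) (int n + j)"

text \<open>This is the effect on coefficients of the factor (1 + z q^(2n+1))(1 + q^(2n+1)/z).
  Everything is expressed through \<open>a\<close>, \<open>b\<close> and the common factor
  \<open>p * w * R\<close>, which leaves the rational identity \<open>key\<close>.\<close>

lemma triple_coeff_Suc:
  assumes "norm q < 1" "q \<noteq> 0"
  shows "triple_coeff q (Suc n) j = (1 + q ^ (4 * n + 2)) * triple_coeff q n j
    + q ^ (2 * n + 1) * (triple_coeff q n (j - 1) + triple_coeff q n (j + 1))"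
proof -
  define Q where "Q = q\<^sup>2"
  have Q: "norm Q < 1" "Q \<noteq> 0"
    using assms by (auto simp: Q_def norm_power power_less_one_iff)
  define a b where "a = Q powi (int n + 1 - j)" and "b = Q powi (int n + 1 + j)"
  \<comment> \<open>These are the largest q-factorial indices that occur, so \<open>rqf_pred\<close>
    writes every other reciprocal as a multiple of them, also when an index is negative.\<close>
  define R where "R = rqf Q (int n + 1 - j) * rqf Q (int n + 1 + j)"
  define p where "p = qpoch Q Q (2 * n)"
  define w where "w = q powi (j ^ 2)"
  have Qq: "Q powi k = q powi (2 * k)" for k
    by (simp add: Q_def power_int_mult)
  have aQ: "Q powi (int n - j) = a / Q" "Q powi (int n + j) = b / Q"
    unfolding a_def b_def using Q(2) by (simp_all add: power_int_diff power_int_add)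
  have r1: "rqf Q (int n - j) = (1 - a) * rqf Q (int n + 1 - j)"
    "rqf Q (int n + j) = (1 - b) * rqf Q (int n + 1 + j)"
    using rqf_pred[OF Q(1), of "int n + 1 - j"] rqf_pred[OF Q(1), of "int n + 1 + j"]
    by (simp_all add: a_def b_def)
  have r2: "rqf Q (int n - j - 1) = (1 - a / Q) * (1 - a) * rqf Q (int n + 1 - j)"
    "rqf Q (int n + j - 1) = (1 - b / Q) * (1 - b) * rqf Q (int n + 1 + j)"
    using rqf_pred[OF Q(1), of "int n - j"] rqf_pred[OF Q(1), of "int n + j"]
    by (simp_all add: aQ r1)
  have ab: "a * b = Q ^ (2 * n + 2)"
  proof -
    have "a * b = Q powi (int (2 * n + 2))"
      unfolding a_def b_def using Q(2) by (simp add: add_ac flip: power_int_add del: power_int_of_nat)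
    then show ?thesis
      by (simp only: power_int_of_nat)
  qed
  have abQ: "a * b / Q = Q ^ (2 * n + 1)"
    unfolding ab using Q(2) by simp
  have abq: "a * b / Q = q ^ (4 * n + 2)"
    unfolding abQ by (simp only: Q_def power_mult[symmetric]) simp
  have P: "qpoch Q Q (2 * Suc n) = p * (1 - a * b / Q) * (1 - a * b)"
    unfolding ab abQ by (simp add: qpoch_def p_def)
  have e1: "q ^ (2 * n + 1) * q powi ((j - 1) ^ 2) = w * a"
  proof -
    have "q powi (int (2 * n + 1)) * q powi ((j - 1) ^ 2) = w * a"
    proof -
      have "int (2 * n + 1) + (j - 1) ^ 2 = j ^ 2 + 2 * (int n + 1 - j)"
        by (simp add: power2_eq_square algebra_simps)
      then show ?thesis
        unfolding w_def a_def Qq using assms(2) by (metis power_int_add)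
    qed
    then show ?thesis
      by (simp only: power_int_of_nat)
  qed
  have e2: "q ^ (2 * n + 1) * q powi ((j + 1) ^ 2) = w * b"
  proof -
    have "q powi (int (2 * n + 1)) * q powi ((j + 1) ^ 2) = w * b"
    proof -
      have "int (2 * n + 1) + (j + 1) ^ 2 = j ^ 2 + 2 * (int n + 1 + j)"
        by (simp add: power2_eq_square algebra_simps)
      then show ?thesis
        unfolding w_def b_def Qq using assms(2) by (metis power_int_add)
    qed
    then show ?thesis
      by (simp only: power_int_of_nat)
  qed
  have T0: "triple_coeff q (Suc n) j = p * (1 - a * b / Q) * (1 - a * b) * w * R"
    unfolding triple_coeff_def Q_def[symmetric] P w_def R_def by (simp add: add_ac)
  have T1: "triple_coeff q n j = p * w * (1 - a) * (1 - b) * R"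
    unfolding triple_coeff_def Q_def[symmetric] p_def w_def R_def r1 by simp
  have T2: "q ^ (2 * n + 1) * triple_coeff q n (j - 1) = p * w * a * (1 - b / Q) * (1 - b) * R"
  proof -
    have i: "int n - (j - 1) = int n + 1 - j" "int n + (j - 1) = int n + j - 1"
      by simp_all
    have "q ^ (2 * n + 1) * triple_coeff q n (j - 1)
      = p * (q ^ (2 * n + 1) * q powi ((j - 1) ^ 2)) * rqf Q (int n + 1 - j) * rqf Q (int n + j - 1)"
      unfolding triple_coeff_def Q_def[symmetric] p_def i by (simp only: mult_ac)
    then show ?thesis
      unfolding e1 r2 R_def by (simp only: mult_ac)
  qed
  have T3: "q ^ (2 * n + 1) * triple_coeff q n (j + 1) = p * w * b * (1 - a / Q) * (1 - a) * R"
  proof -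
    have i: "int n - (j + 1) = int n - j - 1" "int n + (j + 1) = int n + 1 + j"
      by simp_all
    have "q ^ (2 * n + 1) * triple_coeff q n (j + 1)
      = p * (q ^ (2 * n + 1) * q powi ((j + 1) ^ 2)) * rqf Q (int n - j - 1) * rqf Q (int n + 1 + j)"
      unfolding triple_coeff_def Q_def[symmetric] p_def i by (simp only: mult_ac)
    then show ?thesis
      unfolding e2 r2 R_def by (simp only: mult_ac)
  qed
  have key: "(1 - a * b / Q) * (1 - a * b)
    = (1 + a * b / Q) * (1 - a) * (1 - b) + a * (1 - b / Q) * (1 - b) + b * (1 - a / Q) * (1 - a)"
    using Q(2) by (simp add: field_simps)
  have "triple_coeff q (Suc n) j = p * w * R * ((1 - a * b / Q) * (1 - a * b))"
    unfolding T0 by (simp only: mult_ac)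
  also have "\<dots> = (1 + a * b / Q) * (p * w * (1 - a) * (1 - b) * R)
      + (p * w * a * (1 - b / Q) * (1 - b) * R + p * w * b * (1 - a / Q) * (1 - a) * R)"
    unfolding key by (simp only: distrib_left mult_ac add_ac)
  finally show ?thesis
    unfolding T1 distrib_left[of "q ^ (2 * n + 1)"] T2 T3 abq .
qed

lemma finite_triple_product:
  assumes "norm q < 1" "q \<noteq> 0"
  shows "(\<Prod>i=1..n. 1 + 2 * x * q ^ (2 * i - 1) + q ^ (4 * i - 2))
    = (\<Sum>j\<le>n. cheb_coeff x j * triple_coeff q n (int j))"
proof (induction n)
  case 0
  then show ?case
    by (simp add: triple_coeff_def rqf_def qpoch_def)
next
  case (Suc n)
  let ?F = "triple_coeff q n"
  let ?S = "\<Sum>j\<le>n. cheb_coeff x j * ?F (int j)"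
  \<comment> \<open>Beyond \<open>n\<close> the coefficients vanish, so the range can be extended
    and both boundary terms of the summation by parts disappear.\<close>
  have z: "?F (int (Suc n)) = 0" "?F (int (Suc (Suc n))) = 0"
    by (simp_all add: triple_coeff_def)
  have S: "(\<Sum>j\<le>Suc n. cheb_coeff x j * ?F (int j)) = ?S"
    by (simp add: z del: of_nat_Suc)
  have shift: "(\<Sum>j\<le>Suc n. cheb_coeff x j * (?F (int j - 1) + ?F (int j + 1))) = 2 * x * ?S"
    using cheb_coeff_summation_by_parts[of ?F x n] unfolding S z
    by (simp add: triple_coeff_def)
  have "(\<Sum>j\<le>Suc n. cheb_coeff x j * triple_coeff q (Suc n) (int j))
    = (1 + q ^ (4 * n + 2)) * (\<Sum>j\<le>Suc n. cheb_coeff x j * ?F (int j))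
      + q ^ (2 * n + 1) * (\<Sum>j\<le>Suc n. cheb_coeff x j * (?F (int j - 1) + ?F (int j + 1)))"
    unfolding triple_coeff_Suc[OF assms] sum_distrib_left sum.distrib[symmetric]
    by (intro sum.cong refl) (simp only: distrib_left mult_ac)
  also have "\<dots> = ?S * (1 + 2 * x * q ^ (2 * n + 1) + q ^ (4 * n + 2))"
    unfolding S shift by (simp add: algebra_simps)
  finally show ?case
    using Suc.IH by simp
qed

section \<open>The identity\<close>

text \<open>The product (Q;Q)_(2n) inside \<open>triple_coeff\<close>, with Q = q^2, cancels the
  denominator (Q;Q)_(2n-1) up to 1 - Q^(2n). This factor vanishes at \<open>n = 0\<close>, in
  agreement with the convention for the zeroth summand.\<close>

definition lhs_double :: "complex \<Rightarrow> complex \<Rightarrow> nat \<Rightarrow> nat \<Rightarrow> complex" where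
  "lhs_double q x n j = cheb_coeff x j * q powi (int j ^ 2)
     * (q\<^sup>2) powi (int n ^ 2 + (-1) * int n) * (1 - (q\<^sup>2) ^ (2 * n))
     * rqf (q\<^sup>2) (int n - int j) * rqf (q\<^sup>2) (int n + int j)"

definition rhs_double :: "complex \<Rightarrow> complex \<Rightarrow> nat \<Rightarrow> nat \<Rightarrow> complex" where
  "rhs_double q x n j = cheb_coeff x j * q powi (- (int j ^ 2))
     * (q\<^sup>2) powi (2 * int n ^ 2 - int n) * (1 - (q\<^sup>2) ^ (6 * n + 3))"

lemma power2_powi: "(q\<^sup>2) powi k = (q :: complex) powi (2 * k)"
  by (simp add: power_int_mult)

lemma lhs_term_eq:
  assumes "norm q < 1" "q \<noteq> 0"
  shows "lhs_term q x n = (\<Sum>j\<le>n. lhs_double q x n j)"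
proof (cases n)
  case 0
  then show ?thesis
    by (simp add: lhs_term_def lhs_double_def)
next
  case (Suc k)
  define Q where "Q = q\<^sup>2"
  have Q: "norm Q < 1"
    using assms by (auto simp: Q_def norm_power power_less_one_iff)
  have "2 * n \<le> 2 * n\<^sup>2"
    by (simp add: power2_eq_square)
  then have "int (2 * n\<^sup>2 - 2 * n) = 2 * (int n ^ 2 + (-1) * int n)"
    by (simp add: of_nat_diff)
  then have e: "q ^ (2 * n\<^sup>2 - 2 * n) = Q powi (int n ^ 2 + (-1) * int n)"
    unfolding Q_def power2_powi by (metis power_int_of_nat)
  have p: "qpoch Q Q (2 * n) = qpoch Q Q (2 * n - 1) * (1 - Q ^ (2 * n))"
    using Suc by (simp add: qpoch_def)
  have "lhs_term q x n = Q powi (int n ^ 2 + (-1) * int n)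
      * (\<Sum>j\<le>n. cheb_coeff x j * triple_coeff q n (int j)) / qpoch Q Q (2 * n - 1)"
    unfolding lhs_term_def e Q_def[symmetric] finite_triple_product[OF assms] using Suc by simp
  also have "\<dots> = (\<Sum>j\<le>n. lhs_double q x n j)"
    unfolding sum_distrib_left sum_divide_distrib
  proof (rule sum.cong[OF refl])
    fix j
    have cancel: "c * (d * (r * y * w * s * t)) / r = d * w * c * y * s * t" if "r \<noteq> 0"
      for c d r y w s t :: complex
      using that by simp
    show "Q powi (int n ^ 2 + (-1) * int n) * (cheb_coeff x j * triple_coeff q n (int j))
        / qpoch Q Q (2 * n - 1) = lhs_double q x n j"
      unfolding triple_coeff_def lhs_double_def Q_def[symmetric] p
      by (rule cancel[OF qpoch_nonzero[OF Q]])
  qed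
  finally show ?thesis .
qed

lemma rhs_term_eq:
  assumes "q \<noteq> 0"
  shows "rhs_term q x n = (\<Sum>j\<le>n. rhs_double q x n j)"
proof -
  have "2 * n \<le> 4 * n\<^sup>2"
    by (simp add: power2_eq_square)
  then have "int (4 * n\<^sup>2 - 2 * n) = 2 * (2 * int n ^ 2 - int n)"
    by (simp add: of_nat_diff)
  then have e: "q ^ (4 * n\<^sup>2 - 2 * n) = (q\<^sup>2) powi (2 * int n ^ 2 - int n)"
    unfolding power2_powi by (metis power_int_of_nat)
  have e': "q ^ (12 * n + 6) = (q\<^sup>2) ^ (6 * n + 3)"
    by (simp flip: power_mult)
  show ?thesis
    unfolding rhs_term_def rhs_double_def cheb_coeff_def e e' sum_distrib_left atLeast0AtMost
    by (intro sum.cong refl) (simp only: mult_ac)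
qed

text \<open>For n = m + j one has n^2 - n = (j^2 - j) + m^2 + (2j - 1)m. Splitting 1 - Q^(2n)
  therefore turns the left column into the sub- and superdiagonal Durfee sums with N = 2j, the very
  quantities in \<open>column_sums\<close>.\<close>

lemma column_eq:
  assumes "norm q < 1" "q \<noteq> 0"
  shows "(\<Sum>m. lhs_double q x (m + j) j)
    = 1 / qpoch_inf (q\<^sup>2) (q\<^sup>2) * (\<Sum>m. rhs_double q x (m + j) j)"
proof -
  define Q where "Q = q\<^sup>2"
  have Q: "norm Q < 1" "Q \<noteq> 0"
    using assms by (auto simp: Q_def norm_power power_less_one_iff)
  define d where "d = cheb_coeff x j"
  define A where "A = durfee_sum Q (int (2 * j) + 1) (int (2 * j))"
  define P where "P = qpoch_inf Q Q"
  have P: "P \<noteq> 0"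
    unfolding P_def by (rule qpoch_inf_nonzero[OF Q(1)])
  let ?w = "d * q powi (int j ^ 2)"
  have "lhs_double q x (m + j) j
      = ?w * Q powi (int j ^ 2 - int j) * durfee_term Q (int (2 * j) - 1) (int (2 * j)) m
        - ?w * Q powi (int j ^ 2 + int j) * durfee_term Q (int (2 * j) + 1) (int (2 * j)) m" for m
  proof -
    have i: "int (m + j) - int j = int m" "int (m + j) + int j = int m + int (2 * j)"
      by simp_all
    have e1: "Q powi (int (m + j) ^ 2 + (-1) * int (m + j))
      = Q powi (int j ^ 2 - int j) * Q powi (int m ^ 2 + (int (2 * j) - 1) * int m)"
      using Q(2) by (simp add: power2_eq_square algebra_simps flip: power_int_add)
    have "Q powi (int (m + j) ^ 2 + (-1) * int (m + j)) * Q powi (int (2 * (m + j)))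
      = Q powi (int j ^ 2 + int j) * Q powi (int m ^ 2 + (int (2 * j) + 1) * int m)"
      using Q(2) by (simp add: power2_eq_square algebra_simps flip: power_int_add del: power_int_of_nat)
    then have e2: "Q powi (int (m + j) ^ 2 + (-1) * int (m + j)) * Q ^ (2 * (m + j))
      = Q powi (int j ^ 2 + int j) * Q powi (int m ^ 2 + (int (2 * j) + 1) * int m)"
      by (simp only: power_int_of_nat)
    have "lhs_double q x (m + j) j = ?w * rqf Q (int m) * rqf Q (int m + int (2 * j))
       * (Q powi (int (m + j) ^ 2 + (-1) * int (m + j))
          - Q powi (int (m + j) ^ 2 + (-1) * int (m + j)) * Q ^ (2 * (m + j)))"
      unfolding lhs_double_def Q_def[symmetric] d_def[symmetric] i
      by (simp add: algebra_simps)
    then show ?thesis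
      unfolding e2 unfolding e1 durfee_term_def by (simp only: right_diff_distrib mult_ac)
  qed
  then have "(\<Sum>m. lhs_double q x (m + j) j)
      = ?w * Q powi (int j ^ 2 - int j) * durfee_sum Q (int (2 * j) - 1) (int (2 * j))
        - ?w * Q powi (int j ^ 2 + int j) * A"
    unfolding A_def durfee_sum_def
    by (simp only:) (intro sums_unique[symmetric] sums_diff sums_mult summable_sums
      summable_durfee_term[OF Q])
  also have "\<dots> = ?w * Q powi (int j ^ 2 - int j) * ((1 + Q ^ (2 * j)) / P)
        - ?w * Q powi (int j ^ 2 + int j) * A"
    unfolding P_def durfee_sum_subdiagonal[OF Q] ..
  finally have L: "(\<Sum>m. lhs_double q x (m + j) j)
      = ?w * Q powi (int j ^ 2 - int j) * ((1 + Q ^ (2 * j)) / P)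
        - ?w * Q powi (int j ^ 2 + int j) * A" .
  let ?v = "d * q powi (- (int j ^ 2))"
  have "(\<lambda>m. ?v * (Q powi (2 * int (m + j) ^ 2 - int (m + j)) * (1 - Q ^ (6 * (m + j) + 3)))) sums
     (?v * (Q powi (2 * int j ^ 2 - int j) * (1 + Q ^ (2 * j)) - P * Q powi (2 * int j ^ 2 + int j) * A))"
    unfolding P_def A_def by (rule sums_mult[OF column_sums[OF Q]])
  also have "(\<lambda>m. ?v * (Q powi (2 * int (m + j) ^ 2 - int (m + j)) * (1 - Q ^ (6 * (m + j) + 3))))
      = (\<lambda>m. rhs_double q x (m + j) j)"
    unfolding rhs_double_def Q_def d_def by (simp only: mult_ac)
  finally have R: "(\<Sum>m. rhs_double q x (m + j) j)
     = ?v * (Q powi (2 * int j ^ 2 - int j) * (1 + Q ^ (2 * j)) - P * Q powi (2 * int j ^ 2 + int j) * A)"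
    by (rule sums_unique[symmetric])
  \<comment> \<open>Both sides of \<open>f1\<close> have total exponent 3j^2 - 2j, those of
    \<open>f2\<close> have 3j^2 + 2j.\<close>
  have f1: "q powi (- (int j ^ 2)) * Q powi (2 * int j ^ 2 - int j)
      = q powi (int j ^ 2) * Q powi (int j ^ 2 - int j)"
    and f2: "q powi (- (int j ^ 2)) * Q powi (2 * int j ^ 2 + int j)
      = q powi (int j ^ 2) * Q powi (int j ^ 2 + int j)"
    unfolding Q_def power2_powi using assms(2)
    by (simp_all add: algebra_simps flip: power_int_add)
  have "(\<Sum>m. rhs_double q x (m + j) j)
     = d * (q powi (- (int j ^ 2)) * Q powi (2 * int j ^ 2 - int j)) * (1 + Q ^ (2 * j))
       - d * P * (q powi (- (int j ^ 2)) * Q powi (2 * int j ^ 2 + int j)) * A"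
    unfolding R by (simp only: right_diff_distrib mult_ac)
  then show ?thesis
    unfolding f1 f2 L Q_def[symmetric] P_def[symmetric] using P by (simp add: field_simps)
qed

section \<open>Domination of both double series and exchange of summation\<close>

lemma triangular_sums:
  assumes "norm q < 1" "q \<noteq> 0"
  shows "summable (\<lambda>n. \<Sum>j\<le>n. lhs_double q x n j)"
    and "(\<Sum>n. \<Sum>j\<le>n. lhs_double q x n j) = (\<Sum>j. \<Sum>m. lhs_double q x (m + j) j)"
    and "summable (\<lambda>n. \<Sum>j\<le>n. rhs_double q x n j)"
    and "summable (\<lambda>j. \<Sum>m. rhs_double q x (m + j) j)"
    and "(\<Sum>n. \<Sum>j\<le>n. rhs_double q x n j) = (\<Sum>j. \<Sum>m. rhs_double q x (m + j) j)"
proof -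
  define Q where "Q = q\<^sup>2"
  have Q: "norm Q < 1" "Q \<noteq> 0"
    using assms by (auto simp: Q_def norm_power power_less_one_iff)
  obtain K where K: "0 < K" "\<And>k. norm (rqf Q k) \<le> K"
    using rqf_bounded Q by blast
  define a where "a j = (2 * norm x + 2) ^ j * norm q ^ (j\<^sup>2)" for j
  define b where "b n = norm (Q powi (int n ^ 2 + (-1) * int n))" for n
  have a: "summable a" "\<And>j. 0 \<le> a j"
    unfolding a_def using assms by (auto intro: summable_power_mult_power_square)
  have b: "summable b" "\<And>n. 0 \<le> b n"
    unfolding b_def by (intro summable_norm_powi_quadratic[OF Q]) simp
  have sb: "summable (\<lambda>n. b n * c)" for c
    by (rule summable_mult2[OF b(1)])
  have two: "norm (1 - Q ^ k) \<le> 2" for k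
  proof -
    have "norm (1 - Q ^ k) \<le> norm (1 :: complex) + norm (Q ^ k)"
      by (rule norm_triangle_ineq4)
    also have "norm (Q ^ k) \<le> 1"
      using Q by (simp add: norm_power power_le_one)
    finally show ?thesis by simp
  qed
  have nq: "norm (q powi (int j ^ 2)) = norm q ^ (j\<^sup>2)" for j
    by (simp add: norm_power flip: of_nat_power)
  have L: "norm (lhs_double q x n j) \<le> b n * (2 * K * K) * a j" for n j
  proof -
    have "norm (lhs_double q x n j) \<le> (2 * norm x + 2) ^ j * norm q ^ (j\<^sup>2) * b n * 2 * K * K"
      unfolding lhs_double_def Q_def[symmetric] norm_mult nq b_def using K
      by (intro mult_mono two norm_cheb_coeff_le) auto
    then show ?thesis
      by (simp add: a_def mult_ac)
  qed
  \<comment> \<open>For \<open>j\<close> <= \<open>n\<close> the negative power is harmless: 2j^2 <=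
    2n^2 gives 4n^2 - 2n - j^2 >= j^2 + 2n^2 - 2n, so the majorants from the left side serve
    again.\<close>
  have R: "norm (rhs_double q x n j) \<le> b n * 2 * a j" if "j \<le> n" for n j
  proof -
    have "q powi (- (int j ^ 2)) * Q powi (2 * int n ^ 2 - int n)
        = q powi (- (int j ^ 2) + 2 * (2 * int n ^ 2 - int n))"
      unfolding Q_def power2_powi using assms by (simp only: power_int_add simp_thms)
    also have "norm \<dots> \<le> norm q powi (int j ^ 2 + 2 * (int n ^ 2 + (-1) * int n))"
      unfolding norm_power_int
    proof (rule power_int_decreasing)
      have "int j ^ 2 \<le> int n ^ 2"
        using that by (intro power_mono) auto
      then show "int j ^ 2 + 2 * (int n ^ 2 + (-1) * int n)
          \<le> - (int j ^ 2) + 2 * (2 * int n ^ 2 - int n)"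
        by simp
    qed (use assms in auto)
    also have "\<dots> = norm (q powi (int j ^ 2) * Q powi (int n ^ 2 + (-1) * int n))"
      unfolding Q_def power2_powi norm_mult norm_power_int using assms
      by (simp only: power_int_add norm_eq_zero simp_thms)
    also have "\<dots> = norm q ^ (j\<^sup>2) * b n"
      unfolding norm_mult nq b_def ..
    finally have e: "norm (q powi (- (int j ^ 2)) * Q powi (2 * int n ^ 2 - int n))
      \<le> norm q ^ (j\<^sup>2) * b n" .
    have "norm (rhs_double q x n j) = norm (cheb_coeff x j)
        * norm (q powi (- (int j ^ 2)) * Q powi (2 * int n ^ 2 - int n)) * norm (1 - Q ^ (6 * n + 3))"
      unfolding rhs_double_def Q_def[symmetric] norm_mult by (simp only: mult_ac)
    also have "\<dots> \<le> (2 * norm x + 2) ^ j * (norm q ^ (j\<^sup>2) * b n) * 2"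
      using b(2)[of n] by (intro mult_mono two norm_cheb_coeff_le e) auto
    finally show ?thesis
      by (simp add: a_def mult_ac)
  qed
  have nn: "0 \<le> b n * (2 * K * K)" "0 \<le> b n * 2" for n
    using b(2)[of n] K(1) by auto
  show "summable (\<lambda>n. \<Sum>j\<le>n. lhs_double q x n j)"
    "(\<Sum>n. \<Sum>j\<le>n. lhs_double q x n j) = (\<Sum>j. \<Sum>m. lhs_double q x (m + j) j)"
    by (rule triangular_sum_swap[OF a(1) sb a(2) nn(1) L])+
  show "summable (\<lambda>n. \<Sum>j\<le>n. rhs_double q x n j)"
    "summable (\<lambda>j. \<Sum>m. rhs_double q x (m + j) j)"
    "(\<Sum>n. \<Sum>j\<le>n. rhs_double q x n j) = (\<Sum>j. \<Sum>m. rhs_double q x (m + j) j)"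
    using triangular_sum_swap[OF a(1) sb a(2) nn(2) R] by blast+
qed

theorem theorem7p5:
  fixes q x :: complex
  assumes "norm q < 1"
  shows "summable (lhs_term q x) \<and> summable (rhs_term q x) \<and>
         (\<Sum>n. lhs_term q x n) = 1 / qpoch_inf (q\<^sup>2) (q\<^sup>2) * (\<Sum>n. rhs_term q x n)"
proof (cases "q = 0")
  case True
  \<comment> \<open>The case \<open>q = 0\<close> is separate because the expansions use negative
    powers of \<open>q\<close>. The exponent 2n^2 - 2n also vanishes at \<open>n = 1\<close>, so the
    left side contributes its 1 there and the right side at \<open>n = 0\<close>.\<close>
  have l: "lhs_term q x = (\<lambda>n. if n = 1 then 1 else 0)"
  proof
    fix n :: nat
    have "0 < 2 * n\<^sup>2 - 2 * n" if "n \<noteq> 0" "n \<noteq> 1"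
      using that by (simp add: power2_eq_square)
    then show "lhs_term q x n = (if n = 1 then 1 else 0)"
      using True by (auto simp: lhs_term_def qpoch_def)
  qed
  have r: "rhs_term q x = (\<lambda>n. if n = 0 then 1 else 0)"
  proof
    fix n :: nat
    have "0 < 4 * n\<^sup>2 - 2 * n" if "n \<noteq> 0"
      using that by (simp add: power2_eq_square)
    then show "rhs_term q x n = (if n = 0 then 1 else 0)"
      using True by (auto simp: rhs_term_def cheb_V_def)
  qed
  have "qpoch_inf (q\<^sup>2) (q\<^sup>2) = 1"
    using True by (simp add: qpoch_inf_def)
  then show ?thesis
    unfolding l r using sums_single[of 1 "\<lambda>_. 1 :: complex"] sums_single[of 0 "\<lambda>_. 1 :: complex"]
    by (auto simp: sums_iff)
next
  case False
  note q = assms False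
  let ?P = "1 / qpoch_inf (q\<^sup>2) (q\<^sup>2)"
  have eq: "lhs_term q x = (\<lambda>n. \<Sum>j\<le>n. lhs_double q x n j)"
      "rhs_term q x = (\<lambda>n. \<Sum>j\<le>n. rhs_double q x n j)"
    using lhs_term_eq[OF q] rhs_term_eq[OF False] by auto
  \<comment> \<open>Both sides are summed by columns, and \<open>column_eq\<close> matches them one
    \<open>j\<close> at a time.\<close>
  have "(\<Sum>n. lhs_term q x n) = ?P * (\<Sum>n. rhs_term q x n)"
    unfolding eq triangular_sums(2,5)[OF q] column_eq[OF q]
    by (rule suminf_mult[OF triangular_sums(4)[OF q]])
  then show ?thesis
    unfolding eq using triangular_sums[OF q] by blast
qed

end
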